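(* Let $\mathfrak{A}$ be a non-empty index set and let $(\mathcal{X}_{\alpha i})_{(\alpha,i)\in\mathfrak{A}\times\{1,2\}}$ be a family in $\Lambda$. Set $\mathcal{X}_i:=\lor_{\alpha\in\mathfrak{A}}\mathcal{X}_{\alpha i}$ for $i\in\{1,2\}$. Assume that for each finite non-empty $A\subset\mathfrak{A}$, $\mathcal{X}_1$ is conditionally independent of $\mathcal{X}_2$ given $\land_{\alpha\in A}\mathcal{X}_{\alpha 1}$ and also given $\land_{\alpha\in A}\mathcal{X}_{\alpha 2}$. Then $$\land_{\alpha\in\mathfrak{A}}(\mathcal{X}_{\alpha 1}\lor\mathcal{X}_{\alpha 2})=(\land_{\alpha\in\mathfrak{A}}\mathcal{X}_{\alpha 1})\lor(\land_{\alpha\in\mathfrak{A}}\mathcal{X}_{\alpha 2}).$$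
   Context: $(\Omega,\mathcal{M},\mathbb{P})$ is a probability space ($\mathbb{P}$ itself need not be complete). $0_\Lambda:=\mathbb{P}^{-1}(\{0,1\})$ is the collection of all events of $\mathcal{M}$ having probability $0$ or $1$. A sub-$\sigma$-field of $\mathcal{M}$ is called complete if it contains $0_\Lambda$, and $\Lambda$ denotes the collection of all complete sub-$\sigma$-fields of $\mathcal{M}$. For $\mathcal{X},\mathcal{Y}\in\Lambda$, $\mathcal{X}\lor\mathcal{Y}:=\sigma(\mathcal{X}\cup\mathcal{Y})$. For a non-empty family $(\mathcal{X}_t)_{t\in T}$ in $\Lambda$, $\lor_{t\in T}\mathcal{X}_t$ is the smallest complete sub-$\sigma$-field of $\mathcal{M}$ containing $\cup_{t\in T}\mathcal{X}_t$, and $\land_{t\in T}\mathcal{X}_t:=\cap_{t\in T}\mathcal{X}_t$. Index sets are arbitrary. Conditional independence is with respect to $\mathbb{P}$. *)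

theory Defs
  imports "HOL-Probability.Probability"
begin

definition trivial_events :: "'a measure \<Rightarrow> 'a set set" where
  "trivial_events M = {E \<in> sets M. measure M E \<in> {0, 1}}"

text \<open>Sub-\<open>\<sigma>\<close>-fields are represented by their collections of events. Completeness means
  containing all events of \<open>M\<close> of probability 0 or 1; the measure \<open>M\<close> itself need not be
  complete.\<close>

definition complete_subfields :: "'a measure \<Rightarrow> 'a set set set" where
  "complete_subfields M =
     {F. sigma_algebra (space M) F \<and> F \<subseteq> sets M \<and> trivial_events M \<subseteq> F}"

definition field_join :: "'a measure \<Rightarrow> 'a set set \<Rightarrow> 'a set set \<Rightarrow> 'a set set" where
  "field_join M F G = sigma_sets (space M) (F \<union> G)"

text \<open>For a family of elements of \<open>complete_subfields M\<close> the outer intersection is over a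
  non-empty collection, as \<open>sets M\<close> belongs to it.\<close>

definition field_Join :: "'a measure \<Rightarrow> 'i set \<Rightarrow> ('i \<Rightarrow> 'a set set) \<Rightarrow> 'a set set" where
  "field_Join M T F = \<Inter> {G \<in> complete_subfields M. (\<Union>t\<in>T. F t) \<subseteq> G}"

text \<open>Conditional expectations in the library are taken with respect to measures;
  \<open>sigma (space M) H\<close> is the measurable space whose events are those of \<open>H\<close>
  when \<open>H\<close> is a \<open>\<sigma>\<close>-field on \<open>space M\<close>.\<close>

definition cond_indep_given ::
    "'a measure \<Rightarrow> 'a set set \<Rightarrow> 'a set set \<Rightarrow> 'a set set \<Rightarrow> bool" where
  "cond_indep_given M F G H \<longleftrightarrow>
     (\<forall>B\<in>F. \<forall>C\<in>G. AE x in M.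
        real_cond_exp M (sigma (space M) H) (indicator (B \<inter> C)) x =
        real_cond_exp M (sigma (space M) H) (indicator B) x *
        real_cond_exp M (sigma (space M) H) (indicator C) x)"

lemma sets_mem_complete_subfields: "sets M \<in> complete_subfields M"
  by (auto simp: complete_subfields_def trivial_events_def sets.sigma_algebra_axioms)

lemma subalgebra_sigma_complete_subfield:
  assumes "H \<in> complete_subfields M"
  shows "sets (sigma (space M) H) = H" and "subalgebra M (sigma (space M) H)"
proof -
  have H: "sigma_algebra (space M) H" "H \<subseteq> sets M" "H \<subseteq> Pow (space M)"
    using assms sets.space_closed[of M] by (auto simp: complete_subfields_def)
  then show eq: "sets (sigma (space M) H) = H"
    by (simp add: sigma_algebra.sigma_sets_eq)
  show "subalgebra M (sigma (space M) H)"
    using H eq by (simp add: subalgebra_def)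
qed

lemma Inter_mem_complete_subfields:
  assumes "\<F> \<subseteq> complete_subfields M" "\<F> \<noteq> {}"
  shows "\<Inter> \<F> \<in> complete_subfields M"
proof -
  have sa: "sigma_algebra (space M) F" if "F \<in> \<F>" for F
    using that assms(1) by (auto simp: complete_subfields_def)
  have "sigma_algebra (space M) (\<Inter> \<F>)"
    unfolding sigma_algebra_iff2
  proof (intro conjI ballI allI impI)
    show "\<Inter> \<F> \<subseteq> Pow (space M)"
      using assms(2) sa unfolding sigma_algebra_iff2 by blast
  next
    fix A :: "nat \<Rightarrow> 'a set" assume "range A \<subseteq> \<Inter> \<F>"
    then have "range A \<subseteq> F" if "F \<in> \<F>" for F
      using that by blast
    with sa show "\<Union> (range A) \<in> \<Inter> \<F>"
      unfolding sigma_algebra_iff2 by blast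
  qed (use sa in \<open>auto simp: sigma_algebra_iff2\<close>)
  then show ?thesis
    using assms by (fastforce simp: complete_subfields_def)
qed

lemma field_Join_mem_complete_subfields:
  assumes "\<And>t. t \<in> T \<Longrightarrow> F t \<in> complete_subfields M"
  shows "field_Join M T F \<in> complete_subfields M"
  unfolding field_Join_def
proof (rule Inter_mem_complete_subfields)
  have "sets M \<in> {G \<in> complete_subfields M. (\<Union>t\<in>T. F t) \<subseteq> G}"
    using assms sets_mem_complete_subfields by (fastforce simp: complete_subfields_def)
  then show "{G \<in> complete_subfields M. (\<Union>t\<in>T. F t) \<subseteq> G} \<noteq> {}"
    by blast
qed auto

end

theory Submission
  imports Defs
begin

text \<open>Write \<open>\<X>\<^sub>i\<close> for the joins, \<open>Z\<^sub>i\<close> for the meet of the \<open>\<X>\<^sub>\<alpha>\<^sub>i\<close> and \<open>W = Z\<^sub>1 \<or> Z\<^sub>2\<close>. Let \<open>B\<close>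
  belong to every \<open>\<X>\<^sub>\<alpha>\<^sub>1 \<or> \<X>\<^sub>\<alpha>\<^sub>2\<close> and let \<open>F\<close>, \<open>G\<close> be events of \<open>\<X>\<^sub>1\<close>, \<open>\<X>\<^sub>2\<close>. Conditional
  independence given \<open>\<X>\<^sub>\<alpha>\<^sub>2\<close> makes \<open>P(B \<inter> F | \<X>\<^sub>2)\<close> measurable with respect to every \<open>\<X>\<^sub>\<alpha>\<^sub>2\<close>
  (by completeness), hence with respect to \<open>Z\<^sub>2\<close>, so that \<open>P(B \<inter> F \<inter> G)\<close> is the integral of
  \<open>P(G | Z\<^sub>2)\<close> over \<open>B \<inter> F\<close>. Doing the same on the other side, it is the integral of
  \<open>P(F | Z\<^sub>1) P(G | Z\<^sub>2)\<close> over \<open>B\<close>. Applied to events \<open>B\<close> of \<open>W\<close>, this identifies the product as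
  \<open>P(F \<inter> G | W)\<close>; applied to the given \<open>B\<close>, it then shows that the indicator of \<open>B\<close> and
  \<open>P(B | W)\<close> have the same integral over \<open>F \<inter> G\<close>. Hence \<open>B\<close> belongs to \<open>W\<close>.\<close>

section \<open>Conditional probabilities, and joins of complete sub-fields\<close>

abbreviation cond_prob :: "'a measure \<Rightarrow> 'a set set \<Rightarrow> 'a set \<Rightarrow> 'a \<Rightarrow> real" where
  "cond_prob M H A \<equiv> real_cond_exp M (sigma (space M) H) (indicator A)"

lemma complete_subfieldsD:
  assumes "H \<in> complete_subfields M"
  shows "sigma_algebra (space M) H" "H \<subseteq> sets M" "trivial_events M \<subseteq> H"
  using assms by (auto simp: complete_subfields_def)

lemma Int_mem_complete_subfield:
  assumes "H \<in> complete_subfields M" "A \<in> H" "B \<in> H"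
  shows "A \<inter> B \<in> H"
proof -
  interpret sigma_algebra "space M" H
    using complete_subfieldsD(1)[OF assms(1)] .
  show ?thesis
    using assms by blast
qed

lemma space_mem_complete_subfield: "H \<in> complete_subfields M \<Longrightarrow> space M \<in> H"
  using complete_subfieldsD(1)[of H M] by (auto simp: sigma_algebra_iff2 dest!: bspec)

lemma field_join_mem_complete_subfields:
  assumes "F \<in> complete_subfields M" "G \<in> complete_subfields M"
  shows "field_join M F G \<in> complete_subfields M"
proof -
  have sub: "F \<union> G \<subseteq> sets M"
    using assms complete_subfieldsD(2) by blast
  then have "sigma_algebra (space M) (field_join M F G)"
    unfolding field_join_def using sets.space_closed[of M] by (intro sigma_algebra_sigma_sets) auto
  moreover have "field_join M F G \<subseteq> sets M"
    unfolding field_join_def by (rule sets.sigma_sets_subset[OF sub])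
  moreover have "trivial_events M \<subseteq> field_join M F G"
    unfolding field_join_def using complete_subfieldsD(3)[OF assms(1)] by (auto intro: sigma_sets.Basic)
  ultimately show ?thesis
    by (simp add: complete_subfields_def)
qed

lemma
  shows left_subset_field_join: "F \<subseteq> field_join M F G"
    and right_subset_field_join: "G \<subseteq> field_join M F G"
  by (auto simp: field_join_def)

lemma field_join_mono: "F \<subseteq> F' \<Longrightarrow> G \<subseteq> G' \<Longrightarrow> field_join M F G \<subseteq> field_join M F' G'"
  unfolding field_join_def by (rule sigma_sets_mono') auto

lemma field_join_commute: "field_join M F G = field_join M G F"
  by (simp add: field_join_def Un_commute)

lemma subset_field_Join: "t \<in> T \<Longrightarrow> F t \<subseteq> field_Join M T F"
  by (auto simp: field_Join_def)

lemma cond_indep_given_commute: "cond_indep_given M F G H \<Longrightarrow> cond_indep_given M G F H"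
  unfolding cond_indep_given_def by (subst Int_commute, subst mult.commute) blast

lemma measurable_sigma_mono:
  assumes "H \<in> complete_subfields M" "K \<in> complete_subfields M" "H \<subseteq> K"
    and "f \<in> borel_measurable (sigma (space M) H)"
  shows "f \<in> borel_measurable (sigma (space M) K)"
  by (rule borel_measurable_subalgebra[OF _ _ assms(4)])
    (use assms in \<open>auto simp: subalgebra_sigma_complete_subfield(1) space_measure_of_conv\<close>)

section \<open>Boundedness, and the effect of completeness on measurability\<close>

context prob_space
begin

lemma sigma_finite_subalgebra_complete_subfield:
  assumes "H \<in> complete_subfields M"
  shows "sigma_finite_subalgebra M (sigma (space M) H)"
proof -
  interpret finite_measure_subalgebra M "sigma (space M) H"
    by unfold_locales (rule subalgebra_sigma_complete_subfield(2)[OF assms])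
  show ?thesis
    by unfold_locales
qed

lemma integrable_indicator_event: "A \<in> events \<Longrightarrow> integrable M (indicator A :: 'a \<Rightarrow> real)"
  by (simp add: integrable_indicator_iff emeasure_eq_measure)

lemma AE_abs_cond_prob_le_1:
  assumes "H \<in> complete_subfields M" "A \<in> events"
  shows "AE x in M. \<bar>cond_prob M H A x\<bar> \<le> 1"
proof -
  interpret sigma_finite_subalgebra M "sigma (space M) H"
    by (rule sigma_finite_subalgebra_complete_subfield[OF assms(1)])
  have i: "integrable M (indicator A :: 'a \<Rightarrow> real)"
    using assms(2) by (simp add: integrable_indicator_event)
  have "AE x in M. cond_prob M H A x \<ge> 0" "AE x in M. cond_prob M H A x \<le> 1"
    by (rule real_cond_exp_ge_c[OF i] real_cond_exp_le_c[OF i]; simp add: indicator_def)+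
  then show ?thesis
    by eventually_elim auto
qed

lemma integrable_mult_bounded:
  fixes u f :: "'a \<Rightarrow> real"
  assumes "integrable M f" "u \<in> borel_measurable M" "AE x in M. \<bar>u x\<bar> \<le> 1"
  shows "integrable M (\<lambda>x. u x * f x)"
proof (rule Bochner_Integration.integrable_bound[OF assms(1)])
  show "AE x in M. norm (u x * f x) \<le> norm (f x)"
    using assms(3) by eventually_elim (auto simp: abs_mult intro: mult_left_le_one_le)
qed (use assms in auto)

text \<open>The preimages of a Borel set under \<open>f\<close> and \<open>g\<close> differ by two
  null events, and completeness puts both into \<open>H\<close>. So any \<open>M\<close>-measurable
  function that agrees almost everywhere with an \<open>H\<close>-measurable one is itself
  \<open>H\<close>-measurable.\<close>

lemma measurable_complete_subfield_cong_AE: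
  fixes f g :: "'a \<Rightarrow> real"
  assumes H: "H \<in> complete_subfields M"
    and f: "f \<in> borel_measurable (sigma (space M) H)"
    and g[measurable]: "g \<in> borel_measurable M"
    and eq: "AE x in M. f x = g x"
  shows "g \<in> borel_measurable (sigma (space M) H)"
proof (rule measurableI)
  note sets_H = subalgebra_sigma_complete_subfield(1)[OF H]
  interpret sa: sigma_algebra "space M" H
    using complete_subfieldsD(1)[OF H] .
  have [measurable]: "f \<in> borel_measurable M"
    by (rule measurable_from_subalg[OF subalgebra_sigma_complete_subfield(2)[OF H] f])
  have null: "N \<in> H" if "N \<in> events" "AE x in M. x \<notin> N" for N
  proof -
    have "prob N = 0"
      using that by (simp add: AE_iff_measurable[OF _ refl] prob_eq_0)
    then show ?thesis
      using that complete_subfieldsD(3)[OF H] by (auto simp: trivial_events_def)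
  qed
  fix S :: "real set" assume [measurable]: "S \<in> sets borel"
  let ?f = "f -` S \<inter> space M" and ?g = "g -` S \<inter> space M"
  have "?f \<in> H"
    using measurable_sets[OF f \<open>S \<in> sets borel\<close>] by (simp add: sets_H)
  moreover have "?f - ?g \<in> H" "?g - ?f \<in> H"
    by (rule null; use eq in \<open>auto elim!: eventually_mono\<close>)+
  ultimately have "(?f - (?f - ?g)) \<union> (?g - ?f) \<in> H"
    by blast
  also have "(?f - (?f - ?g)) \<union> (?g - ?f) = ?g"
    by blast
  finally show "g -` S \<inter> space (sigma (space M) H) \<in> sets (sigma (space M) H)"
    by (simp add: sets_H)
qed simp

section \<open>Testing integrals on joins and against bounded weights\<close>

text \<open>A pi-lambda argument: the intersections \<open>A \<inter> B\<close> form an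
  intersection-stable generator of the join, and the events over which \<open>f\<close> and
  \<open>g\<close> have equal integrals form a Dynkin system.\<close>

lemma set_integral_eq_field_join:
  fixes f g :: "'a \<Rightarrow> real"
  assumes H: "H \<in> complete_subfields M" and K: "K \<in> complete_subfields M"
    and f: "integrable M f" and g: "integrable M g"
    and eq: "\<And>A B. A \<in> H \<Longrightarrow> B \<in> K \<Longrightarrow> (LINT x:A \<inter> B|M. f x) = (LINT x:A \<inter> B|M. g x)"
    and C: "C \<in> field_join M H K"
  shows "(LINT x:C|M. f x) = (LINT x:C|M. g x)"
proof -
  define P where "P = {A \<inter> B | A B. A \<in> H \<and> B \<in> K}"
  note HM = complete_subfieldsD(2)[OF H] and KM = complete_subfieldsD(2)[OF K]
  have spH: "space M \<in> H" and spK: "space M \<in> K"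
    using space_mem_complete_subfield H K by blast+
  have PM: "P \<subseteq> events"
    using HM KM by (auto simp: P_def)
  have int: "set_integrable M A h" if "A \<in> events" "integrable M h" for A and h :: "'a \<Rightarrow> real"
    unfolding set_integrable_def by (rule integrable_mult_indicator[OF that])
  have "H \<union> K \<subseteq> P"
  proof -
    have "A = A \<inter> space M" "A = space M \<inter> A" if "A \<in> H \<union> K" for A
      using that HM KM sets.sets_into_space by blast+
    then show ?thesis
      using spH spK unfolding P_def by blast
  qed
  then have CP: "C \<in> sigma_sets (space M) P"
    using C sigma_sets_mono'[of "H \<union> K" P] by (auto simp: field_join_def)
  have "Int_stable P"
  proof (rule Int_stableI)
    fix S S' assume "S \<in> P" "S' \<in> P"
    then obtain A B A' B' where "S = A \<inter> B" "S' = A' \<inter> B'" "A \<in> H" "A' \<in> H" "B \<in> K" "B' \<in> K"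
      by (auto simp: P_def)
    then have "S \<inter> S' = (A \<inter> A') \<inter> (B \<inter> B')" "A \<inter> A' \<in> H" "B \<inter> B' \<in> K"
      using Int_mem_complete_subfield H K by auto
    then show "S \<inter> S' \<in> P"
      unfolding P_def by blast
  qed
  moreover have "P \<subseteq> Pow (space M)"
    using PM sets.space_closed by blast
  ultimately show ?thesis
    using CP
  proof (induction rule: sigma_sets_induct_disjoint)
    case (basic A)
    then show ?case
      using eq by (auto simp: P_def)
  next
    case empty
    show ?case
      by (simp add: set_lebesgue_integral_def)
  next
    case (compl A)
    have A: "A \<in> events"
      using compl sets.sigma_sets_subset[OF PM] by blast
    have *: "(LINT x:space M - A|M. h x) = (LINT x:space M|M. h x) - (LINT x:A|M. h x)"
      if "integrable M h" for h :: "'a \<Rightarrow> real"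
    proof -
      have "(LINT x:(space M - A) \<union> A|M. h x) = (LINT x:space M - A|M. h x) + (LINT x:A|M. h x)"
        using A that by (intro set_integral_Un int) auto
      moreover have "(space M - A) \<union> A = space M"
        using sets.sets_into_space[OF A] by blast
      ultimately show ?thesis
        by simp
    qed
    \<comment> \<open>The integrals over the whole space agree because \<open>eq\<close> may be
      taken at \<open>A = B = space M\<close>.\<close>
    show ?case
      using compl eq[OF spH spK] by (simp add: *[OF f] *[OF g])
  next
    case (union A)
    have A: "A i \<in> events" for i
      using union sets.sigma_sets_subset[OF PM] by blast
    then have "(\<Union>i. A i) \<in> events"
      by blast
    then show ?case
      using union A
      by (simp add: lebesgue_integral_countable_add[of A] int f g disjoint_family_on_def)
  qed
qed

text \<open>Equal integrals over all events of \<open>H\<close> mean equal conditional expectations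
  given \<open>H\<close>, through which the \<open>H\<close>-measurable weight \<open>v\<close> can
  be pulled. This avoids approximating \<open>v\<close> by simple functions.\<close>

lemma integral_mult_cong_set_integral:
  fixes f g v :: "'a \<Rightarrow> real"
  assumes H: "H \<in> complete_subfields M"
    and f: "integrable M f" and g: "integrable M g"
    and eq: "\<And>A. A \<in> H \<Longrightarrow> (LINT x:A|M. f x) = (LINT x:A|M. g x)"
    and v: "v \<in> borel_measurable (sigma (space M) H)" and v1: "AE x in M. \<bar>v x\<bar> \<le> 1"
  shows "(LINT x|M. v x * f x) = (LINT x|M. v x * g x)"
proof -
  let ?S = "sigma (space M) H"
  interpret sigma_finite_subalgebra M ?S
    by (rule sigma_finite_subalgebra_complete_subfield[OF H])
  have vM: "v \<in> borel_measurable M"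
    by (rule measurable_from_subalg[OF subalg v])
  have "AE x in M. real_cond_exp M ?S f x = real_cond_exp M ?S g x"
  proof (rule real_cond_exp_charact)
    fix A assume "A \<in> sets ?S"
    then show "(LINT x:A|M. f x) = (LINT x:A|M. real_cond_exp M ?S g x)"
      using eq[of A] real_cond_exp_intA[OF g, of A] by (simp add: subalgebra_sigma_complete_subfield(1)[OF H])
  qed (use f g in auto)
  then have "(LINT x|M. v x * real_cond_exp M ?S f x) = (LINT x|M. v x * real_cond_exp M ?S g x)"
    using vM by (intro integral_cong_AE) auto
  then show ?thesis
    using f g v vM v1 by (simp add: real_cond_exp_intg(2) integrable_mult_bounded)
qed

lemma integral_mult_cond_prob:
  fixes w :: "'a \<Rightarrow> real"
  assumes H: "H \<in> complete_subfields M" and A: "A \<in> events"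
    and w: "w \<in> borel_measurable (sigma (space M) H)" and w1: "AE x in M. \<bar>w x\<bar> \<le> 1"
  shows "(LINT x|M. w x * cond_prob M H A x) = (LINT x|M. w x * indicator A x)"
proof -
  interpret sigma_finite_subalgebra M "sigma (space M) H"
    by (rule sigma_finite_subalgebra_complete_subfield[OF H])
  have "w \<in> borel_measurable M"
    by (rule measurable_from_subalg[OF subalg w])
  then show ?thesis
    using A w w1 by (intro real_cond_exp_intg(2) integrable_mult_bounded) (auto simp: integrable_indicator_event)
qed

lemma integrable_cond_prob:
  assumes "H \<in> complete_subfields M" "A \<in> events"
  shows "integrable M (cond_prob M H A)"
proof -
  interpret sigma_finite_subalgebra M "sigma (space M) H"
    by (rule sigma_finite_subalgebra_complete_subfield[OF assms(1)])
  show ?thesis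
    using assms(2) by (intro real_cond_exp_int(1)) (auto simp: integrable_indicator_event)
qed

section \<open>Consequences of conditional independence\<close>

text \<open>The integrated form of P(G | H \<or> K) = P(G | K): once \<open>K\<close> is known,
  \<open>H\<close> says nothing more about \<open>G\<close>. It suffices to test on
  \<open>A \<inter> B\<close> with \<open>A\<close> in \<open>H\<close> and \<open>B\<close> in
  \<open>K\<close>, where conditioning on \<open>K\<close> lets the product formula act.\<close>

lemma set_integral_cond_prob_field_join:
  assumes H: "H \<in> complete_subfields M" and L: "L \<in> complete_subfields M"
    and K: "K \<in> complete_subfields M"
    and indep: "cond_indep_given M H L K"
    and C: "C \<in> field_join M H K" and G: "G \<in> L"
  shows "(LINT x:C|M. indicator G x) = (LINT x:C|M. cond_prob M K G x)"
proof (rule set_integral_eq_field_join[OF H K _ _ _ C])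
  have GM: "G \<in> events"
    using G complete_subfieldsD(2)[OF L] by blast
  then show "integrable M (indicator G :: 'a \<Rightarrow> real)"
    by (simp add: integrable_indicator_event)
  show "integrable M (cond_prob M K G)"
    by (rule integrable_cond_prob[OF K GM])
  interpret K: sigma_finite_subalgebra M "sigma (space M) K"
    by (rule sigma_finite_subalgebra_complete_subfield[OF K])
  fix A B assume A: "A \<in> H" and B: "B \<in> K"
  have AM: "A \<in> events" and BM: "B \<in> events"
    using A B complete_subfieldsD(2) H K by blast+
  have [measurable]: "B \<in> sets (sigma (space M) K)"
    using B by (simp add: subalgebra_sigma_complete_subfield(1)[OF K])
  have "(LINT x:A \<inter> B|M. indicator G x) = (LINT x|M. indicator B x * indicator (A \<inter> G) x :: real)"
    by (auto simp: set_lebesgue_integral_def indicator_def intro!: Bochner_Integration.integral_cong)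
  also have "\<dots> = (LINT x|M. indicator B x * cond_prob M K (A \<inter> G) x)"
    using AM GM by (intro integral_mult_cond_prob[OF K, symmetric]) (auto simp: indicator_def)
  \<comment> \<open>After factoring, P(G | K) is grouped with the indicator of \<open>B\<close> into
    one bounded \<open>K\<close>-measurable weight, so that the conditioning of \<open>A\<close> can
    then be undone.\<close>
  also have "\<dots> = (LINT x|M. (indicator B x * cond_prob M K G x) * cond_prob M K A x)"
  proof (rule integral_cong_AE)
    have "AE x in M. cond_prob M K (A \<inter> G) x = cond_prob M K A x * cond_prob M K G x"
      using indep A G by (simp add: cond_indep_given_def)
    then show "AE x in M. indicator B x * cond_prob M K (A \<inter> G) x =
        (indicator B x * cond_prob M K G x) * cond_prob M K A x"
      by eventually_elim simp
  qed (use BM in auto)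
  also have "\<dots> = (LINT x|M. (indicator B x * cond_prob M K G x) * indicator A x)"
    using AE_abs_cond_prob_le_1[OF K GM]
    by (intro integral_mult_cond_prob[OF K AM]) (auto elim!: eventually_mono simp: indicator_def)
  also have "\<dots> = (LINT x:A \<inter> B|M. cond_prob M K G x)"
    by (auto simp: set_lebesgue_integral_def indicator_def intro!: Bochner_Integration.integral_cong)
  finally show "(LINT x:A \<inter> B|M. indicator G x) = (LINT x:A \<inter> B|M. cond_prob M K G x)" .
qed

text \<open>As \<open>K\<close> lies in \<open>L\<close>, P(C | K) is an \<open>L\<close>-measurable
  candidate for P(C | L). Against \<open>G\<close> in \<open>L\<close> it passes the test because
  both integrals equal that of P(G | K) P(C | K), an expression symmetric in \<open>C\<close> and
  \<open>G\<close>.\<close>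

lemma cond_prob_AE_eq_of_cond_indep_given:
  assumes H: "H \<in> complete_subfields M" and L: "L \<in> complete_subfields M"
    and K: "K \<in> complete_subfields M" and KL: "K \<subseteq> L"
    and indep: "cond_indep_given M H L K"
    and C: "C \<in> field_join M H K"
  shows "AE x in M. cond_prob M L C x = cond_prob M K C x"
proof -
  interpret L: sigma_finite_subalgebra M "sigma (space M) L"
    by (rule sigma_finite_subalgebra_complete_subfield[OF L])
  interpret K: sigma_finite_subalgebra M "sigma (space M) K"
    by (rule sigma_finite_subalgebra_complete_subfield[OF K])
  have CM: "C \<in> events"
    using C field_join_mem_complete_subfields[OF H K] complete_subfieldsD(2) by blast
  show ?thesis
  proof (rule L.real_cond_exp_charact)
    show "integrable M (indicator C :: 'a \<Rightarrow> real)"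
      using CM by (simp add: integrable_indicator_event)
    show "integrable M (cond_prob M K C)"
      by (rule integrable_cond_prob[OF K CM])
    show "cond_prob M K C \<in> borel_measurable (sigma (space M) L)"
      by (rule measurable_sigma_mono[OF K L KL borel_measurable_cond_exp])
    fix G assume "G \<in> sets (sigma (space M) L)"
    then have G: "G \<in> L"
      by (simp add: subalgebra_sigma_complete_subfield(1)[OF L])
    have GM: "G \<in> events"
      using G complete_subfieldsD(2)[OF L] by blast
    have "(LINT x:G|M. indicator C x) = (LINT x:C|M. indicator G x :: real)"
      by (simp add: set_lebesgue_integral_def mult.commute)
    also have "\<dots> = (LINT x:C|M. cond_prob M K G x)"
      by (rule set_integral_cond_prob_field_join[OF H L K indep C G])
    also have "\<dots> = (LINT x|M. cond_prob M K G x * indicator C x)"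
      by (simp add: set_lebesgue_integral_def mult.commute)
    also have "\<dots> = (LINT x|M. cond_prob M K G x * cond_prob M K C x)"
      by (rule integral_mult_cond_prob[symmetric, OF K CM _ AE_abs_cond_prob_le_1[OF K GM]]) simp
    also have "\<dots> = (LINT x|M. cond_prob M K C x * indicator G x)"
      by (subst mult.commute, rule integral_mult_cond_prob[OF K GM _ AE_abs_cond_prob_le_1[OF K CM]]) simp
    also have "\<dots> = (LINT x:G|M. cond_prob M K C x)"
      by (simp add: set_lebesgue_integral_def mult.commute)
    finally show "(LINT x:G|M. indicator C x) = (LINT x:G|M. cond_prob M K C x)" .
  qed
qed

text \<open>Carries the integral formula from the single fields \<open>K t\<close> to their meet.
  The one function \<open>w\<close> = P(C | L) agrees almost everywhere with each P(C | K t), so by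
  completeness it is measurable for each \<open>K t\<close>, hence for the meet. The null events are
  absorbed for each \<open>t\<close> separately, so \<open>T\<close> may be uncountable.\<close>

lemma set_integral_cond_prob_Inter:
  assumes H: "H \<in> complete_subfields M" and L: "L \<in> complete_subfields M"
    and T: "T \<noteq> {}"
    and K: "\<And>t. t \<in> T \<Longrightarrow> K t \<in> complete_subfields M" "\<And>t. t \<in> T \<Longrightarrow> K t \<subseteq> L"
    and indep: "\<And>t. t \<in> T \<Longrightarrow> cond_indep_given M H L (K t)"
    and C: "\<And>t. t \<in> T \<Longrightarrow> C \<in> field_join M H (K t)" and G: "G \<in> L"
  shows "(LINT x:C|M. indicator G x) = (LINT x:C|M. cond_prob M (\<Inter>t\<in>T. K t) G x)"
proof -
  let ?Z = "\<Inter>t\<in>T. K t"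
  have Z: "?Z \<in> complete_subfields M"
    using T K(1) by (intro Inter_mem_complete_subfields) auto
  obtain t where "t \<in> T"
    using T by blast
  then have CM: "C \<in> events"
    using C field_join_mem_complete_subfields[OF H K(1)] complete_subfieldsD(2) by blast
  have GM: "G \<in> events"
    using G complete_subfieldsD(2)[OF L] by blast
  have ZL: "?Z \<subseteq> L"
    using \<open>t \<in> T\<close> K(2) by blast
  define w where "w = cond_prob M L C"
  have w1: "AE x in M. \<bar>w x\<bar> \<le> 1"
    unfolding w_def by (rule AE_abs_cond_prob_le_1[OF L CM])
  have wK: "w \<in> borel_measurable (sigma (space M) (K t))" if "t \<in> T" for t
  proof (rule measurable_complete_subfield_cong_AE[OF K(1)[OF that] borel_measurable_cond_exp])
    show "AE x in M. cond_prob M (K t) C x = w x"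
      using cond_prob_AE_eq_of_cond_indep_given[OF H L K[OF that] indep[OF that] C[OF that]]
      unfolding w_def by eventually_elim simp
  qed (simp add: w_def)
  have wZ: "w \<in> borel_measurable (sigma (space M) ?Z)"
  proof (rule measurableI)
    fix S :: "real set" assume S: "S \<in> sets borel"
    have "w -` S \<inter> space M \<in> K t" if "t \<in> T" for t
      using measurable_sets[OF wK[OF that] S] by (simp add: subalgebra_sigma_complete_subfield(1)[OF K(1)[OF that]] space_measure_of_conv)
    then show "w -` S \<inter> space (sigma (space M) ?Z) \<in> sets (sigma (space M) ?Z)"
      unfolding subalgebra_sigma_complete_subfield(1)[OF Z] by (simp add: space_measure_of_conv)
  qed simp
  have vL: "cond_prob M ?Z G \<in> borel_measurable (sigma (space M) L)"
    by (rule measurable_sigma_mono[OF Z L ZL borel_measurable_cond_exp])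
  have [measurable]: "G \<in> sets (sigma (space M) L)"
    using G by (simp add: subalgebra_sigma_complete_subfield(1)[OF L])
  have "(LINT x:C|M. indicator G x) = (LINT x|M. indicator G x * indicator C x :: real)"
    by (simp add: set_lebesgue_integral_def mult.commute)
  also have "\<dots> = (LINT x|M. indicator G x * w x)"
    unfolding w_def by (rule integral_mult_cond_prob[symmetric, OF L CM]) (auto simp: indicator_def)
  \<comment> \<open>Measurability of \<open>w\<close> for the meet allows conditioning
    \<open>G\<close> on it. Next, P(G | Z) is \<open>L\<close>-measurable, so \<open>w\<close> can
    be turned back into the indicator of \<open>C\<close>.\<close>
  also have "\<dots> = (LINT x|M. w x * cond_prob M ?Z G x)"
    using integral_mult_cond_prob[OF Z GM wZ w1] by (simp add: mult.commute)
  also have "\<dots> = (LINT x|M. cond_prob M ?Z G x * indicator C x)"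
    using integral_mult_cond_prob[OF L CM vL AE_abs_cond_prob_le_1[OF Z GM]]
    by (simp add: w_def mult.commute)
  also have "\<dots> = (LINT x:C|M. cond_prob M ?Z G x)"
    by (simp add: set_lebesgue_integral_def mult.commute)
  finally show ?thesis .
qed

section \<open>The exchange of meets and joins\<close>

text \<open>The argument sees the two joins only as complete upper bounds of their families, so they
  are replaced by arbitrary such fields \<open>HK\<close> and \<open>HL\<close>.\<close>

lemma Inter_field_join_eq:
  fixes T :: "'i set" and K L :: "'i \<Rightarrow> 'a set set"
  assumes T: "T \<noteq> {}"
    and HK: "HK \<in> complete_subfields M" and HL: "HL \<in> complete_subfields M"
    and K: "\<And>t. t \<in> T \<Longrightarrow> K t \<in> complete_subfields M" "\<And>t. t \<in> T \<Longrightarrow> K t \<subseteq> HK"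
    and L: "\<And>t. t \<in> T \<Longrightarrow> L t \<in> complete_subfields M" "\<And>t. t \<in> T \<Longrightarrow> L t \<subseteq> HL"
    and indepK: "\<And>t. t \<in> T \<Longrightarrow> cond_indep_given M HK HL (K t)"
    and indepL: "\<And>t. t \<in> T \<Longrightarrow> cond_indep_given M HK HL (L t)"
  shows "(\<Inter>t\<in>T. field_join M (K t) (L t)) = field_join M (\<Inter>t\<in>T. K t) (\<Inter>t\<in>T. L t)"
    (is "?D = field_join M ?Y ?Z")
proof
  let ?W = "field_join M ?Y ?Z"
  show WD: "?W \<subseteq> ?D"
    by (intro INT_greatest field_join_mono) auto
  have Y: "?Y \<in> complete_subfields M" and Z: "?Z \<in> complete_subfields M"
    using T K(1) L(1) by (auto intro!: Inter_mem_complete_subfields)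
  note W = field_join_mem_complete_subfields[OF Y Z]
  note J = field_join_mem_complete_subfields[OF HK HL]
  interpret W: sigma_finite_subalgebra M "sigma (space M) ?W"
    by (rule sigma_finite_subalgebra_complete_subfield[OF W])
  interpret J: sigma_finite_subalgebra M "sigma (space M) (field_join M HK HL)"
    by (rule sigma_finite_subalgebra_complete_subfield[OF J])
  obtain t0 where t0: "t0 \<in> T"
    using T by blast
  have DJ: "?D \<subseteq> field_join M HK HL"
    using t0 field_join_mono[OF K(2) L(2)] by blast
  have ZHL: "?Z \<subseteq> HL"
    using t0 L(2) by blast
  let ?u = "cond_prob M ?Y" and ?v = "cond_prob M ?Z"
  have uW: "?u F \<in> borel_measurable (sigma (space M) ?W)" for F
    by (rule measurable_sigma_mono[OF Y W left_subset_field_join borel_measurable_cond_exp])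
  have vW: "?v G \<in> borel_measurable (sigma (space M) ?W)" for G
    by (rule measurable_sigma_mono[OF Z W right_subset_field_join borel_measurable_cond_exp])
  have uv1: "AE x in M. \<bar>?u F x * ?v G x\<bar> \<le> 1" if "F \<in> events" "G \<in> events" for F G
    using AE_abs_cond_prob_le_1[OF Y that(1)] AE_abs_cond_prob_le_1[OF Z that(2)]
    by eventually_elim (simp add: abs_mult mult_le_one)
  \<comment> \<open>Kept general in \<open>B\<close>: it is used for all events of
    \<open>?W\<close>, to identify a conditional probability, and then for the event whose
    membership in \<open>?W\<close> is sought.\<close>
  have factor: "(LINT x:B|M. indicator (F \<inter> G) x) = (LINT x:B|M. ?u F x * ?v G x)"
    if B: "B \<in> ?D" and F: "F \<in> HK" and G: "G \<in> HL" for B F G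
  proof -
    have BM: "B \<in> events" and FM: "F \<in> events" and GM: "G \<in> events"
      using B F G DJ complete_subfieldsD(2)[OF J] complete_subfieldsD(2)[OF HK]
        complete_subfieldsD(2)[OF HL] by blast+
    have "(LINT x:B|M. indicator (F \<inter> G) x) = (LINT x:B \<inter> F|M. indicator G x :: real)"
      by (auto simp: set_lebesgue_integral_def indicator_def intro!: Bochner_Integration.integral_cong)
    also have "\<dots> = (LINT x:B \<inter> F|M. ?v G x)"
    proof (rule set_integral_cond_prob_Inter[OF HK HL T L indepL _ G])
      fix t assume t: "t \<in> T"
      \<comment> \<open>Enlarging \<open>K t\<close> to \<open>HK\<close> makes room for the
        intersection with \<open>F\<close>.\<close>
      have "B \<in> field_join M HK (L t)"
        using B t field_join_mono[OF K(2)[OF t] order_refl] by blast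
      then show "B \<inter> F \<in> field_join M HK (L t)"
        using F left_subset_field_join field_join_mem_complete_subfields[OF HK L(1)[OF t]]
          Int_mem_complete_subfield by blast
    qed
    also have "\<dots> = (LINT x|M. ?v G x * indicator (B \<inter> F) x)"
      by (simp add: set_lebesgue_integral_def mult.commute)
    \<comment> \<open>The weight P(G | Z) is \<open>HL\<close>-measurable, so comparing integrals
      over events \<open>A\<close> of \<open>HL\<close> suffices. Each \<open>B \<inter> A\<close>
      lies in every join of \<open>HL\<close> with \<open>K t\<close>, and the preceding argument
      applies with the two sides exchanged.\<close>
    also have "\<dots> = (LINT x|M. ?v G x * (indicator B x * ?u F x))"
    proof (rule integral_mult_cong_set_integral[OF HL])
      show "integrable M (indicator (B \<inter> F) :: 'a \<Rightarrow> real)"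
        using BM FM by (simp add: integrable_indicator_event)
      show "integrable M (\<lambda>x. indicator B x * ?u F x)"
        using integrable_mult_indicator[OF BM integrable_cond_prob[OF Y FM]] by simp
      show "?v G \<in> borel_measurable (sigma (space M) HL)"
        by (rule measurable_sigma_mono[OF Z HL ZHL borel_measurable_cond_exp])
      show "AE x in M. \<bar>?v G x\<bar> \<le> 1"
        by (rule AE_abs_cond_prob_le_1[OF Z GM])
      fix A assume A: "A \<in> HL"
      have "(LINT x:A|M. indicator (B \<inter> F) x) = (LINT x:B \<inter> A|M. indicator F x :: real)"
        by (auto simp: set_lebesgue_integral_def indicator_def intro!: Bochner_Integration.integral_cong)
      also have "\<dots> = (LINT x:B \<inter> A|M. ?u F x)"
      proof (rule set_integral_cond_prob_Inter[OF HL HK T K cond_indep_given_commute[OF indepK] _ F])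
        fix t assume t: "t \<in> T"
        have "B \<in> field_join M HL (K t)"
          using B t field_join_mono[OF order_refl L(2)[OF t], of M "K t"]
          unfolding field_join_commute[of M HL] by blast
        then show "B \<inter> A \<in> field_join M HL (K t)"
          using A left_subset_field_join field_join_mem_complete_subfields[OF HL K(1)[OF t]]
            Int_mem_complete_subfield by blast
      qed
      also have "\<dots> = (LINT x:A|M. indicator B x * ?u F x)"
        by (auto simp: set_lebesgue_integral_def indicator_def intro!: Bochner_Integration.integral_cong)
      finally show "(LINT x:A|M. indicator (B \<inter> F) x) = (LINT x:A|M. indicator B x * ?u F x)" .
    qed
    also have "\<dots> = (LINT x:B|M. ?u F x * ?v G x)"
      by (simp add: set_lebesgue_integral_def mult_ac)
    finally show ?thesis .
  qed
  show "?D \<subseteq> ?W"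
  proof
    fix B assume B: "B \<in> ?D"
    have BJ: "B \<in> field_join M HK HL" and BM: "B \<in> events"
      using B DJ complete_subfieldsD(2)[OF J] by blast+
    let ?w = "cond_prob M ?W B"
    have iB: "integrable M (indicator B :: 'a \<Rightarrow> real)"
      using BM by (simp add: integrable_indicator_event)
    have iw: "integrable M ?w"
      by (rule integrable_cond_prob[OF W BM])
    have eq: "(LINT x:F \<inter> G|M. indicator B x) = (LINT x:F \<inter> G|M. ?w x)"
      if F: "F \<in> HK" and G: "G \<in> HL" for F G
    proof -
      have FM: "F \<in> events" and GM: "G \<in> events"
        using F G complete_subfieldsD(2)[OF HK] complete_subfieldsD(2)[OF HL] by blast+
      have uv: "(\<lambda>x. ?u F x * ?v G x) \<in> borel_measurable (sigma (space M) ?W)"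
        using uW vW by (rule borel_measurable_times)
      have uvM: "(\<lambda>x. ?u F x * ?v G x) \<in> borel_measurable M"
        by (rule measurable_from_subalg[OF W.subalg uv])
      \<comment> \<open>Every event of \<open>?W\<close> belongs to \<open>?D\<close>, so
        \<open>factor\<close> gives exactly the defining integrals of P(F \<inter> G | W).\<close>
      have *: "AE x in M. cond_prob M ?W (F \<inter> G) x = ?u F x * ?v G x"
      proof (rule W.real_cond_exp_charact)
        show "integrable M (indicator (F \<inter> G) :: 'a \<Rightarrow> real)"
          using FM GM by (simp add: integrable_indicator_event)
        show "integrable M (\<lambda>x. ?u F x * ?v G x)"
          using integrable_mult_bounded[OF _ uvM uv1[OF FM GM], of "\<lambda>_. 1"] by simp
        show "(LINT x:A|M. indicator (F \<inter> G) x) = (LINT x:A|M. ?u F x * ?v G x)"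
          if "A \<in> sets (sigma (space M) ?W)" for A
          using that WD factor[OF _ F G] unfolding subalgebra_sigma_complete_subfield(1)[OF W] by blast
      qed (fact uv)
      have "(LINT x:F \<inter> G|M. indicator B x) = (LINT x:B|M. indicator (F \<inter> G) x :: real)"
        by (simp add: set_lebesgue_integral_def mult.commute)
      also have "\<dots> = (LINT x:B|M. ?u F x * ?v G x)"
        by (rule factor[OF B F G])
      also have "\<dots> = (LINT x|M. (?u F x * ?v G x) * indicator B x)"
        by (simp add: set_lebesgue_integral_def mult.commute)
      also have "\<dots> = (LINT x|M. (?u F x * ?v G x) * ?w x)"
        by (rule integral_mult_cond_prob[symmetric, OF W BM uv uv1[OF FM GM]])
      also have "\<dots> = (LINT x|M. ?w x * cond_prob M ?W (F \<inter> G) x)"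
        by (rule integral_cong_AE) (use uvM * in \<open>auto elim!: eventually_mono\<close>)
      also have "\<dots> = (LINT x|M. ?w x * indicator (F \<inter> G) x)"
        using FM GM by (intro integral_mult_cond_prob[OF W _ _ AE_abs_cond_prob_le_1[OF W BM]]) auto
      also have "\<dots> = (LINT x:F \<inter> G|M. ?w x)"
        by (simp add: set_lebesgue_integral_def mult.commute)
      finally show ?thesis .
    qed
    \<comment> \<open>Agreement on all \<open>F \<inter> G\<close> extends to the join of
      \<open>HK\<close> and \<open>HL\<close>, which contains both \<open>?W\<close> and
      \<open>B\<close>. So P(B | W) is also the conditional probability of \<open>B\<close> given
      that join, which is the indicator of \<open>B\<close>.\<close>
    have "AE x in M. cond_prob M (field_join M HK HL) B x = ?w x"
    proof (rule J.real_cond_exp_charact[OF _ iB iw])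
      show "(LINT x:C|M. indicator B x) = (LINT x:C|M. ?w x)"
        if "C \<in> sets (sigma (space M) (field_join M HK HL))" for C
        using that set_integral_eq_field_join[OF HK HL iB iw eq]
        unfolding subalgebra_sigma_complete_subfield(1)[OF J] by blast
      show "?w \<in> borel_measurable (sigma (space M) (field_join M HK HL))"
        using WD DJ by (intro measurable_sigma_mono[OF W J _ borel_measurable_cond_exp]) blast
    qed
    moreover have "AE x in M. cond_prob M (field_join M HK HL) B x = indicator B x"
    proof (rule J.real_cond_exp_F_meas[OF iB])
      show "(indicator B :: 'a \<Rightarrow> real) \<in> borel_measurable (sigma (space M) (field_join M HK HL))"
        using BJ subalgebra_sigma_complete_subfield(1)[OF J] by (intro borel_measurable_indicator) simp
    qed
    ultimately have "AE x in M. ?w x = indicator B x"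
      by eventually_elim simp
    \<comment> \<open>Completeness of \<open>?W\<close> upgrades almost sure equality to actual
      measurability.\<close>
    then have "(indicator B :: 'a \<Rightarrow> real) \<in> borel_measurable (sigma (space M) ?W)"
      using BM by (intro measurable_complete_subfield_cong_AE[OF W borel_measurable_cond_exp]) auto
    then have "B \<inter> space M \<in> ?W"
      by (simp add: borel_measurable_indicator_iff space_measure_of_conv subalgebra_sigma_complete_subfield(1)[OF W])
    then show "B \<in> ?W"
      using sets.sets_into_space[OF BM] by (simp add: Int_absorb2)
  qed
qed

end

theorem proposition3p24:
  fixes M :: "'a measure" and \<AA> :: "'i set" and \<X> :: "'i \<Rightarrow> nat \<Rightarrow> 'a set set"
  assumes "prob_space M"
    and "\<AA> \<noteq> {}"
    and "\<And>\<alpha> i. \<alpha> \<in> \<AA> \<Longrightarrow> i \<in> {1, 2} \<Longrightarrow> \<X> \<alpha> i \<in> complete_subfields M"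
    and "\<And>A. finite A \<Longrightarrow> A \<noteq> {} \<Longrightarrow> A \<subseteq> \<AA> \<Longrightarrow>
           cond_indep_given M (field_Join M \<AA> (\<lambda>\<alpha>. \<X> \<alpha> 1)) (field_Join M \<AA> (\<lambda>\<alpha>. \<X> \<alpha> 2)) (\<Inter>\<alpha>\<in>A. \<X> \<alpha> 1) \<and>
           cond_indep_given M (field_Join M \<AA> (\<lambda>\<alpha>. \<X> \<alpha> 1)) (field_Join M \<AA> (\<lambda>\<alpha>. \<X> \<alpha> 2)) (\<Inter>\<alpha>\<in>A. \<X> \<alpha> 2)"
  shows "(\<Inter>\<alpha>\<in>\<AA>. field_join M (\<X> \<alpha> 1) (\<X> \<alpha> 2)) =
           field_join M (\<Inter>\<alpha>\<in>\<AA>. \<X> \<alpha> 1) (\<Inter>\<alpha>\<in>\<AA>. \<X> \<alpha> 2)"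
proof -
  interpret prob_space M by fact
  \<comment> \<open>The assumption at the one-element set \<open>{\<alpha>}\<close>, whose meet is
    \<open>\<X> \<alpha> i\<close> itself.\<close>
  have indep: "cond_indep_given M (field_Join M \<AA> (\<lambda>\<alpha>. \<X> \<alpha> 1)) (field_Join M \<AA> (\<lambda>\<alpha>. \<X> \<alpha> 2)) (\<X> \<alpha> i)"
    if "\<alpha> \<in> \<AA>" "i \<in> {1, 2}" for \<alpha> i
    using assms(4)[of "{\<alpha>}"] that by auto
  show ?thesis
  proof (rule Inter_field_join_eq[OF assms(2)])
    show "field_Join M \<AA> (\<lambda>\<alpha>. \<X> \<alpha> 1) \<in> complete_subfields M"
      "field_Join M \<AA> (\<lambda>\<alpha>. \<X> \<alpha> 2) \<in> complete_subfields M"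
      by (rule field_Join_mem_complete_subfields, rule assms(3); simp)+
    fix \<alpha> assume \<alpha>: "\<alpha> \<in> \<AA>"
    show "\<X> \<alpha> 1 \<in> complete_subfields M" "\<X> \<alpha> 2 \<in> complete_subfields M"
      using assms(3)[OF \<alpha>] by auto
    show "\<X> \<alpha> 1 \<subseteq> field_Join M \<AA> (\<lambda>\<alpha>. \<X> \<alpha> 1)" "\<X> \<alpha> 2 \<subseteq> field_Join M \<AA> (\<lambda>\<alpha>. \<X> \<alpha> 2)"
      using subset_field_Join[OF \<alpha>, of "\<lambda>\<alpha>. \<X> \<alpha> 1"] subset_field_Join[OF \<alpha>, of "\<lambda>\<alpha>. \<X> \<alpha> 2"] by auto
    show "cond_indep_given M (field_Join M \<AA> (\<lambda>\<alpha>. \<X> \<alpha> 1)) (field_Join M \<AA> (\<lambda>\<alpha>. \<X> \<alpha> 2)) (\<X> \<alpha> 1)"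
      "cond_indep_given M (field_Join M \<AA> (\<lambda>\<alpha>. \<X> \<alpha> 1)) (field_Join M \<AA> (\<lambda>\<alpha>. \<X> \<alpha> 2)) (\<X> \<alpha> 2)"
      using indep[OF \<alpha>] by auto
  qed
qed

end
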